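(* Every finite dimensional r-Pick space $H$ is r-orthogonal.
   Context: A finite dimensional reproducing kernel Hilbert space (RKHS) $H$ is a complex inner product space with a distinguished basis $\{k_i\}_{i=1}^n$ of vectors called reproducing kernels, indexed by a set $X(H)=\{x_i\}_{i=1}^n$; vectors are regarded as functions on $X(H)$ via $h(x_i)=\langle h,k_i\rangle$. It is assumed that any two kernels are linearly independent and $\langle k_i,k_j\rangle\ne0$ for all $i,j$. Its Gram matrix is $G(H)=(\langle k_i,k_j\rangle)$. Two RKHS $H,\widetilde H$ of the same finite dimension are rescalings of each other, $H\sim\widetilde H$, if there are a bijection $\Xi:X(H)\to X(\widetilde H)$ and a nowhere vanishing $\gamma:X(H)\to\mathbb{C}$ such that $\langle\tilde k_{\Xi(x)},\tilde k_{\Xi(y)}\rangle=\gamma(x)\overline{\gamma(y)}\langle k_x,k_y\rangle$ for all $x,y\in X(H)$. $H$ is orthogonal if its Gram matrix $K$ satisfies $K^tK=I$ (equivalently, the conjugate linear map sending each $k_i$ to the corresponding element $f_i$ of the dual basis, $\langle k_i,f_j\rangle=\delta_{ij}$, is an isometric involution of $H$). $H$ is r-orthogonal if it is a rescaling of an orthogonal RKHS. A Pick space is a space $DA_1(X)$ with $X$ a finite subset of the open unit disk $\mathbb{D}$: the span, in the Hardy space $H^2=DA_1$ with kernels $k_z(w)=(1-\bar zw)^{-1}$, of $\{k_x\}_{x\in X}$, with this set as distinguished basis. An r-Pick space is an RKHS that is a rescaling of a Pick space. *)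

theory Defs
  imports "HOL-Complex_Analysis.Complex_Analysis" "HOL-Library.Function_Algebras"
begin

section \<open>Complex inner product spaces\<close>

text \<open>The carrier \<open>V\<close> is a subspace of an ambient complex vector space (the whole type \<open>'v\<close>);
  the form \<open>ip\<close> is linear in its first argument.\<close>

locale complex_inner_space = vector_space scale
  for scale :: "complex \<Rightarrow> 'v::ab_group_add \<Rightarrow> 'v" +
  fixes V :: "'v set" and ip :: "'v \<Rightarrow> 'v \<Rightarrow> complex"
  assumes subspace_carrier: "subspace V"
    and ip_add_left: "\<lbrakk>u \<in> V; v \<in> V; w \<in> V\<rbrakk> \<Longrightarrow> ip (u + v) w = ip u w + ip v w"
    and ip_scale_left: "\<lbrakk>u \<in> V; v \<in> V\<rbrakk> \<Longrightarrow> ip (scale c u) v = c * ip u v"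
    and ip_cnj: "\<lbrakk>u \<in> V; v \<in> V\<rbrakk> \<Longrightarrow> ip u v = cnj (ip v u)"
    and ip_pos: "\<lbrakk>v \<in> V; v \<noteq> 0\<rbrakk> \<Longrightarrow> Re (ip v v) > 0"

lemma (in complex_inner_space) complex_inner_space_subspace:
  assumes "subspace W" "W \<subseteq> V"
  shows "complex_inner_space scale W ip"
proof
  show "subspace W" by fact
  show "ip (u + v) w = ip u w + ip v w" if "u \<in> W" "v \<in> W" "w \<in> W" for u v w
    using assms(2) that ip_add_left by blast
  show "ip (scale c u) v = c * ip u v" if "u \<in> W" "v \<in> W" for c u v
    using assms(2) that ip_scale_left by blast
  show "ip u v = cnj (ip v u)" if "u \<in> W" "v \<in> W" for u v
    using assms(2) that ip_cnj by blast
  show "Re (ip v v) > 0" if "v \<in> W" "v \<noteq> 0" for v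
    using assms(2) that ip_pos by blast
qed


section \<open>Finite dimensional RKHS\<close>

record ('x, 'v) rkhs =
  scal :: "complex \<Rightarrow> 'v \<Rightarrow> 'v"
  vecs :: "'v set"
  inn :: "'v \<Rightarrow> 'v \<Rightarrow> complex"
  pts :: "'x set"
  kern :: "'x \<Rightarrow> 'v"

text \<open>The kernels, indexed by the points, form a basis; in particular any two of them are linearly
  independent.\<close>

locale fd_rkhs = complex_inner_space "scal H" "vecs H" "inn H"
  for H :: "('x, 'v::ab_group_add) rkhs" +
  assumes finite_pts: "finite (pts H)"
    and inj_kernel: "inj_on (kern H) (pts H)"
    and independent_kernels: "independent (kern H ` pts H)"
    and span_kernels: "span (kern H ` pts H) = vecs H"
    and inn_kernel_nonzero:
      "\<lbrakk>x \<in> pts H; y \<in> pts H\<rbrakk> \<Longrightarrow> inn H (kern H x) (kern H y) \<noteq> 0"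

definition gram :: "('x, 'v) rkhs \<Rightarrow> 'x \<Rightarrow> 'x \<Rightarrow> complex" where
  "gram H x y = inn H (kern H x) (kern H y)"

definition rescaling :: "('x, 'v) rkhs \<Rightarrow> ('y, 'w) rkhs \<Rightarrow> bool" where
  "rescaling H H' \<longleftrightarrow>
     (\<exists>\<Xi> \<gamma>. bij_betw \<Xi> (pts H) (pts H') \<and> (\<forall>x\<in>pts H. \<gamma> x \<noteq> 0) \<and>
        (\<forall>x\<in>pts H. \<forall>y\<in>pts H. gram H' (\<Xi> x) (\<Xi> y) = \<gamma> x * cnj (\<gamma> y) * gram H x y))"

text \<open>Entrywise \<open>K\<^sup>t K = I\<close> for the Gram matrix \<open>K\<close> (plain transpose, no conjugation).\<close>

definition orthogonal_rkhs :: "('x, 'v) rkhs \<Rightarrow> bool" where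
  "orthogonal_rkhs H \<longleftrightarrow>
     (\<forall>x\<in>pts H. \<forall>y\<in>pts H.
        (\<Sum>z\<in>pts H. gram H z x * gram H z y) = (if x = y then 1 else 0))"

text \<open>Taking the orthogonal space over the types of \<open>H\<close> loses no generality: any rescaling of \<open>H\<close>
  is isometric to \<open>vecs H\<close> with the kernels \<open>\<gamma> x k\<^sub>x\<close>.\<close>

definition r_orthogonal :: "('x, 'v::ab_group_add) rkhs \<Rightarrow> bool" where
  "r_orthogonal H \<longleftrightarrow>
     fd_rkhs H \<and> (\<exists>H' :: ('x, 'v) rkhs. fd_rkhs H' \<and> orthogonal_rkhs H' \<and> rescaling H' H)"


section \<open>Hardy space and Pick spaces\<close>

definition fun_scale :: "complex \<Rightarrow> (complex \<Rightarrow> complex) \<Rightarrow> complex \<Rightarrow> complex" where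
  "fun_scale c f = (\<lambda>z. c * f z)"

text \<open>Functions on the disk are total functions vanishing outside it.\<close>

definition hardy_space :: "(complex \<Rightarrow> complex) set" where
  "hardy_space = {f. f holomorphic_on ball 0 1 \<and> (\<forall>z. z \<notin> ball 0 1 \<longrightarrow> f z = 0) \<and>
     summable (\<lambda>n. (cmod (fps_nth (fps_expansion f 0) n))\<^sup>2)}"

definition hardy_inner :: "(complex \<Rightarrow> complex) \<Rightarrow> (complex \<Rightarrow> complex) \<Rightarrow> complex" where
  "hardy_inner f g = (\<Sum>n. fps_nth (fps_expansion f 0) n * cnj (fps_nth (fps_expansion g 0) n))"

definition szego_kernel :: "complex \<Rightarrow> complex \<Rightarrow> complex" where
  "szego_kernel z w = (if w \<in> ball 0 1 then 1 / (1 - cnj z * w) else 0)"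

definition pick_space :: "complex set \<Rightarrow> (complex, complex \<Rightarrow> complex) rkhs" where
  "pick_space X =
     \<lparr>scal = fun_scale, vecs = module.span fun_scale (szego_kernel ` X), inn = hardy_inner,
      pts = X, kern = szego_kernel\<rparr>"

definition r_pick :: "('x, 'v::ab_group_add) rkhs \<Rightarrow> bool" where
  "r_pick H \<longleftrightarrow>
     fd_rkhs H \<and> (\<exists>X. finite X \<and> X \<subseteq> ball 0 1 \<and> rescaling (pick_space X) H)"

subsection \<open>Pick spaces are RKHS inside the Hardy space\<close>

interpretation fun_vs: vector_space fun_scale
  by unfold_locales (auto simp: fun_scale_def fun_eq_iff algebra_simps)

lemma coeff_hardy_add:
  assumes "f \<in> hardy_space" "g \<in> hardy_space"
  shows "fps_nth (fps_expansion (f + g) 0) n =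
           fps_nth (fps_expansion f 0) n + fps_nth (fps_expansion g 0) n"
  using assms higher_deriv_add[of f "ball 0 1" g 0 n]
  by (simp add: hardy_space_def fps_expansion_def plus_fun_def add_divide_distrib)

lemma coeff_hardy_scale:
  assumes "f \<in> hardy_space"
  shows "fps_nth (fps_expansion (fun_scale c f) 0) n = c * fps_nth (fps_expansion f 0) n"
  using assms higher_deriv_cmult[of f "ball 0 1" 0 n c]
  by (simp add: fun_scale_def hardy_space_def fps_expansion_def)

lemma summable_hardy_inner:
  assumes "f \<in> hardy_space" "g \<in> hardy_space"
  shows "summable (\<lambda>n. fps_nth (fps_expansion f 0) n * cnj (fps_nth (fps_expansion g 0) n))"
proof (rule summable_comparison_test')
  show "summable (\<lambda>n. (cmod (fps_nth (fps_expansion f 0) n))\<^sup>2 +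
                      (cmod (fps_nth (fps_expansion g 0) n))\<^sup>2)"
    using assms by (intro summable_add) (auto simp: hardy_space_def)
  fix n :: nat
  have "a * b \<le> a\<^sup>2 + b\<^sup>2" if "a \<ge> 0" "b \<ge> 0" for a b :: real
    using sum_squares_bound[of a b] mult_nonneg_nonneg[OF that] by linarith
  then show "norm (fps_nth (fps_expansion f 0) n * cnj (fps_nth (fps_expansion g 0) n)) \<le>
      (cmod (fps_nth (fps_expansion f 0) n))\<^sup>2 + (cmod (fps_nth (fps_expansion g 0) n))\<^sup>2"
    by (simp add: norm_mult)
qed

lemma subspace_hardy_space: "fun_vs.subspace hardy_space"
proof (rule fun_vs.subspaceI)
  have "(deriv ^^ n) (\<lambda>z. 0 :: complex) 0 = 0" for n
    by simp
  then show "0 \<in> hardy_space"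
    by (simp add: hardy_space_def fps_expansion_def zero_fun_def)
next
  fix f g assume fg: "f \<in> hardy_space" "g \<in> hardy_space"
  have "summable (\<lambda>n. (cmod (fps_nth (fps_expansion f 0) n + fps_nth (fps_expansion g 0) n))\<^sup>2)"
  proof (rule summable_comparison_test')
    show "summable (\<lambda>n. 2 * (cmod (fps_nth (fps_expansion f 0) n))\<^sup>2 +
                        2 * (cmod (fps_nth (fps_expansion g 0) n))\<^sup>2)"
      using fg by (intro summable_add summable_mult) (auto simp: hardy_space_def)
    fix n :: nat
    let ?a = "fps_nth (fps_expansion f 0) n" and ?b = "fps_nth (fps_expansion g 0) n"
    have "(cmod (?a + ?b))\<^sup>2 \<le> (cmod ?a + cmod ?b)\<^sup>2"
      by (intro power_mono norm_triangle_ineq) simp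
    also have "\<dots> \<le> 2 * (cmod ?a)\<^sup>2 + 2 * (cmod ?b)\<^sup>2"
      using sum_squares_bound[of "cmod ?a" "cmod ?b"] by (simp add: power2_sum)
    finally show "norm ((cmod (?a + ?b))\<^sup>2) \<le> 2 * (cmod ?a)\<^sup>2 + 2 * (cmod ?b)\<^sup>2"
      by simp
  qed
  with fg coeff_hardy_add[OF fg] show "f + g \<in> hardy_space"
    by (auto simp: hardy_space_def plus_fun_def intro: holomorphic_intros)
next
  fix c f assume f: "f \<in> hardy_space"
  then show "fun_scale c f \<in> hardy_space"
    using coeff_hardy_scale[OF f, of c]
    by (auto simp: fun_scale_def hardy_space_def norm_mult power_mult_distrib intro: holomorphic_intros summable_mult)
qed

lemma complex_inner_space_hardy: "complex_inner_space fun_scale hardy_space hardy_inner"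
proof
  show "fun_vs.subspace hardy_space" by (rule subspace_hardy_space)
next
  fix f g h assume "f \<in> hardy_space" "g \<in> hardy_space" "h \<in> hardy_space"
  then show "hardy_inner (f + g) h = hardy_inner f h + hardy_inner g h"
    by (simp add: hardy_inner_def coeff_hardy_add distrib_right suminf_add summable_hardy_inner)
next
  fix c f g assume "f \<in> hardy_space" "g \<in> hardy_space"
  then show "hardy_inner (fun_scale c f) g = c * hardy_inner f g"
    by (simp add: hardy_inner_def coeff_hardy_scale mult.assoc suminf_mult summable_hardy_inner)
next
  fix f g assume "f \<in> hardy_space" "g \<in> hardy_space"
  then have "(\<lambda>n. fps_nth (fps_expansion g 0) n * cnj (fps_nth (fps_expansion f 0) n)) sums
               hardy_inner g f"
    unfolding hardy_inner_def by (intro summable_sums summable_hardy_inner)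
  then have "(\<lambda>n. fps_nth (fps_expansion f 0) n * cnj (fps_nth (fps_expansion g 0) n)) sums
               cnj (hardy_inner g f)"
    by (subst sums_cnj[symmetric]) (simp add: mult.commute)
  then show "hardy_inner f g = cnj (hardy_inner g f)"
    unfolding hardy_inner_def[of f g] by (simp add: sums_iff)
next
  fix f assume f: "f \<in> hardy_space" "f \<noteq> 0"
  have "\<exists>n. fps_nth (fps_expansion f 0) n \<noteq> 0"
  proof (rule ccontr)
    assume "\<not> ?thesis"
    then have "f w = 0" if "w \<in> ball 0 1" for w
      using f that by (intro holomorphic_fun_eq_0_on_ball[of f 0 1])
        (auto simp: hardy_space_def fps_expansion_def)
    with f show False by (auto simp: hardy_space_def fun_eq_iff)
  qed
  then obtain n where n: "fps_nth (fps_expansion f 0) n \<noteq> 0" by blast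
  have "Re (hardy_inner f f) = (\<Sum>n. (cmod (fps_nth (fps_expansion f 0) n))\<^sup>2)"
    unfolding hardy_inner_def using f summable_hardy_inner[of f f]
    by (subst Re_suminf) (auto simp: complex_mult_cnj cmod_power2)
  also have "\<dots> > 0"
    using f n by (intro suminf_pos2[where i = n]) (auto simp: hardy_space_def)
  finally show "Re (hardy_inner f f) > 0" .
qed

lemma cnj_mult_ne_1:
  assumes "z \<in> ball 0 1" "w \<in> ball 0 1"
  shows "cnj z * w \<noteq> (1 :: complex)"
proof -
  have "cmod z * cmod w < 1 * 1"
    using assms by (intro mult_strict_mono') auto
  then have "cmod (cnj z * w) < 1"
    by (simp add: norm_mult)
  then show ?thesis by (metis norm_one less_irrefl)
qed

lemma coeff_szego_kernel: "fps_nth (fps_expansion (szego_kernel z) 0) n = cnj z ^ n"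
proof -
  have "(\<lambda>w. 1 / (1 - cnj z * w)) has_fps_expansion 1 / (1 - fps_const (cnj z) * fps_X)"
    by (intro fps_expansion_intros) auto
  moreover have "eventually (\<lambda>w. w \<in> ball 0 1) (nhds (0 :: complex))"
    by (intro eventually_nhds_in_open) auto
  then have "eventually (\<lambda>w. 1 / (1 - cnj z * w) = szego_kernel z w) (nhds 0)"
    by eventually_elim (simp add: szego_kernel_def)
  ultimately have "szego_kernel z has_fps_expansion 1 / (1 - fps_const (cnj z) * fps_X)"
    using has_fps_expansion_cong[OF _ refl] by metis
  then have "fps_expansion (szego_kernel z) 0 = 1 / (1 - fps_const (cnj z) * fps_X)"
    using fps_expansion_eqI by blast
  also have "\<dots> = Abs_fps (\<lambda>n. cnj z ^ n)"
  proof -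
    have "(1 - fps_const (cnj z) * fps_X) * Abs_fps (\<lambda>n. cnj z ^ n) = 1"
    proof (rule fps_ext)
      fix n
      show "fps_nth ((1 - fps_const (cnj z) * fps_X) * Abs_fps (\<lambda>n. cnj z ^ n)) n =
              fps_nth 1 n"
        by (cases n) (simp_all add: left_diff_distrib mult.assoc)
    qed
    from fps_inverse_unique[OF this] show ?thesis
      by (simp add: fps_divide_unit)
  qed
  finally show ?thesis by simp
qed

lemma szego_kernel_in_hardy_space:
  assumes "z \<in> ball 0 1"
  shows "szego_kernel z \<in> hardy_space"
proof -
  have "(\<lambda>w. 1 / (1 - cnj z * w)) holomorphic_on ball 0 1"
    using cnj_mult_ne_1[OF assms] by (intro holomorphic_intros) auto
  then have "szego_kernel z holomorphic_on ball 0 1"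
    by (rule holomorphic_transform) (simp add: szego_kernel_def)
  moreover have "summable (\<lambda>n. ((cmod z)\<^sup>2) ^ n)"
    using assms by (intro summable_geometric) (simp add: abs_square_less_1)
  ultimately show ?thesis
    by (simp add: hardy_space_def coeff_szego_kernel szego_kernel_def norm_power
        flip: power_mult mult.commute[of 2])
qed

lemma hardy_inner_szego_kernel:
  assumes "z \<in> ball 0 1" "w \<in> ball 0 1"
  shows "hardy_inner (szego_kernel z) (szego_kernel w) = 1 / (1 - cnj z * w)"
proof -
  have "cmod z * cmod w < 1 * 1"
    using assms by (intro mult_strict_mono') auto
  then show ?thesis
    by (simp add: hardy_inner_def coeff_szego_kernel norm_mult suminf_geometric
        flip: power_mult_distrib)
qed

lemma szego_kernel_sum_zero:
  assumes X: "finite X" "X \<subseteq> ball 0 1" and x: "x \<in> X"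
    and zero: "(\<Sum>y\<in>X. fun_scale (c y) (szego_kernel y)) = 0"
  shows "c x = 0"
proof -
  have coeff_sum: "(\<Sum>y\<in>Y. fun_scale (c y) (szego_kernel y)) \<in> hardy_space \<and>
      fps_nth (fps_expansion (\<Sum>y\<in>Y. fun_scale (c y) (szego_kernel y)) 0) n =
        (\<Sum>y\<in>Y. c y * cnj y ^ n)" if "Y \<subseteq> X" for Y n
    using finite_subset[OF that X(1)] that
  proof (induction Y rule: finite_induct)
    case empty
    then show ?case
      using coeff_hardy_scale[OF fun_vs.subspace_0[OF subspace_hardy_space], of 0]
        fun_vs.subspace_0[OF subspace_hardy_space]
      by (simp add: zero_fun_def)
  next
    case (insert y Y)
    have y: "szego_kernel y \<in> hardy_space"
      using insert X by (intro szego_kernel_in_hardy_space) auto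
    have cy: "fun_scale (c y) (szego_kernel y) \<in> hardy_space"
      using fun_vs.subspace_scale[OF subspace_hardy_space y] .
    have IH: "(\<Sum>y\<in>Y. fun_scale (c y) (szego_kernel y)) \<in> hardy_space"
      using insert by blast
    have "(\<Sum>y\<in>insert y Y. fun_scale (c y) (szego_kernel y)) =
            fun_scale (c y) (szego_kernel y) + (\<Sum>y\<in>Y. fun_scale (c y) (szego_kernel y))"
      using insert by (intro sum.insert)
    then show ?case
      using insert fun_vs.subspace_add[OF subspace_hardy_space cy IH] coeff_hardy_add[OF cy IH, of n]
      by (simp only: coeff_hardy_scale[OF y] coeff_szego_kernel) simp
  qed
  have moments: "(\<Sum>y\<in>X. c y * cnj y ^ n) = 0" for n
  proof -
    have "fps_nth (fps_expansion (0 :: complex \<Rightarrow> complex) 0) n = 0"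
      using coeff_hardy_scale[OF fun_vs.subspace_0[OF subspace_hardy_space], of 0]
      by (simp add: fun_scale_def zero_fun_def)
    then show ?thesis using coeff_sum[of X n] zero by simp
  qed
  define p where "p = (\<Prod>y\<in>X - {x}. [:- cnj y, 1:])"
  have p0: "poly p (cnj y) = 0" if "y \<in> X" "y \<noteq> x" for y
    using that X by (auto simp: p_def poly_prod)
  have p1: "poly p (cnj x) \<noteq> 0"
    using X by (auto simp: p_def poly_prod)
  have "0 = (\<Sum>i\<le>degree p. coeff p i * (\<Sum>y\<in>X. c y * cnj y ^ i))"
    by (simp add: moments)
  also have "\<dots> = (\<Sum>y\<in>X. c y * poly p (cnj y))"
    unfolding poly_altdef sum_distrib_left
    by (subst sum.swap) (simp add: mult_ac)
  also have "\<dots> = c x * poly p (cnj x)"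
    using X x p0 by (subst sum.remove[OF X(1) x]) simp
  finally show ?thesis using p1 by simp
qed

lemma inj_on_szego_kernel: "inj_on szego_kernel X"
proof
  fix x y assume "szego_kernel x = szego_kernel y"
  then show "x = y"
    using coeff_szego_kernel[of x 1] coeff_szego_kernel[of y 1] by simp
qed

lemma pick_space_simps:
  "scal (pick_space X) = fun_scale" "vecs (pick_space X) = fun_vs.span (szego_kernel ` X)"
  "inn (pick_space X) = hardy_inner" "pts (pick_space X) = X" "kern (pick_space X) = szego_kernel"
  by (simp_all add: pick_space_def)

lemma vecs_pick_space_subset:
  assumes "X \<subseteq> ball 0 1"
  shows "vecs (pick_space X) \<subseteq> hardy_space"
proof -
  have "szego_kernel ` X \<subseteq> hardy_space"
    using assms szego_kernel_in_hardy_space by blast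
  from fun_vs.span_minimal[OF this subspace_hardy_space] show ?thesis
    unfolding pick_space_simps .
qed

lemma fd_rkhs_pick_space:
  assumes X: "finite X" "X \<subseteq> ball 0 1"
  shows "fd_rkhs (pick_space X)"
proof -
  interpret hardy: complex_inner_space fun_scale hardy_space hardy_inner
    by (rule complex_inner_space_hardy)
  have "complex_inner_space (scal (pick_space X)) (vecs (pick_space X)) (inn (pick_space X))"
    using hardy.complex_inner_space_subspace[OF _ vecs_pick_space_subset[OF X(2)]]
    by (simp add: pick_space_simps)
  moreover have "fun_vs.independent (szego_kernel ` X)"
  proof
    assume "fun_vs.dependent (szego_kernel ` X)"
    then obtain c x where x: "x \<in> X" "c (szego_kernel x) \<noteq> 0"
      and zero: "(\<Sum>v\<in>szego_kernel ` X. fun_scale (c v) v) = 0"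
      using X by (auto simp: fun_vs.dependent_finite)
    define d where "d y = c (szego_kernel y)" for y
    have "(\<Sum>y\<in>X. fun_scale (d y) (szego_kernel y)) = 0"
      using zero by (simp add: sum.reindex[OF inj_on_szego_kernel] d_def)
    from szego_kernel_sum_zero[where c = d, OF X x(1) this] x(2) show False
      by (simp add: d_def)
  qed
  moreover have "hardy_inner (szego_kernel x) (szego_kernel y) \<noteq> 0" if "x \<in> X" "y \<in> X" for x y
    using cnj_mult_ne_1[of x y] hardy_inner_szego_kernel[of x y] subsetD[OF X(2)] that by simp
  ultimately show ?thesis
    unfolding fd_rkhs_def fd_rkhs_axioms_def pick_space_simps
    using X(1) inj_on_szego_kernel by blast
qed

end

(* For a finite X in the disk the matrix (1 / (1 - cnj z * x)) is a Cauchy matrix, and Lagrange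
   interpolation at the nodes cnj z evaluates
     (SUM z:X. s z / ((1 - cnj z * x) * (1 - cnj z * y)))
   for the residue weights s z of the Blaschke product with zero set X: it vanishes for x ~= y
   and equals 1 / cnj (s x) for x = y. Multiplying each kernel by a square root of its weight
   therefore makes the Gram matrix K satisfy K^t K = I. *)

theory Submission
  imports Defs
begin

text \<open>Lagrange interpolation of the polynomial \<open>\<Prod>w\<in>Y. 1 - t * b w\<close> at the nodes \<open>a z\<close>, evaluated
  at \<open>t = 1 / x\<close> and multiplied by \<open>x ^ card Y\<close>. The homogeneous form is needed because \<open>0\<close> may
  be among the points; it reaches \<open>x = 0\<close> by continuity.\<close>

lemma homogeneous_lagrange_interpolation:
  fixes a :: "'i \<Rightarrow> complex" and b :: "'j \<Rightarrow> complex"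
  assumes X: "finite X" "inj_on a X" and Y: "finite Y" "Suc (card Y) = card X"
  shows "(\<Prod>w\<in>Y. x - b w) =
    (\<Sum>z\<in>X. (\<Prod>w\<in>Y. 1 - a z * b w) * (\<Prod>w\<in>X - {z}. (1 - x * a w) / (a z - a w)))"
    (is "?f x = ?g x")
proof -
  have nonzero: "?f u = ?g u" if u: "u \<noteq> 0" for u
  proof -
    define p where "p = (\<Prod>w\<in>Y. [:1, - b w:])"
    define q where "q = (\<Sum>z\<in>X. smult ((\<Prod>w\<in>Y. 1 - a z * b w) / (\<Prod>w\<in>X - {z}. a z - a w))
                                      (\<Prod>w\<in>X - {z}. [:- a w, 1:]))"
    have "degree p \<le> (\<Sum>w\<in>Y. 1)"
      unfolding p_def by (rule order_trans[OF degree_prod_sum_le[OF Y(1)]]) (intro sum_mono, simp)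
    then have degp: "degree p < card X" using Y by simp
    have "degree q \<le> card X - 1"
      unfolding q_def
    proof (intro degree_sum_le order_trans[OF degree_smult_le] X(1))
      fix z assume "z \<in> X"
      have "degree (\<Prod>w\<in>X - {z}. [:- a w, 1:]) \<le> (\<Sum>w\<in>X - {z}. 1)"
        by (rule order_trans[OF degree_prod_sum_le]) (use X in \<open>auto intro!: sum_mono\<close>)
      then show "degree (\<Prod>w\<in>X - {z}. [:- a w, 1:]) \<le> card X - 1"
        using X \<open>z \<in> X\<close> by simp
    qed
    then have degq: "degree q < card X" using Y by linarith
    have "p = q"
    proof (rule poly_eqI_degree[where A = "a ` X"])
      show "degree p < card (a ` X)" "degree q < card (a ` X)"
        using degp degq X by (simp_all add: card_image)
      fix t assume "t \<in> a ` X"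
      then obtain v where v: "v \<in> X" "t = a v" by blast
      have "poly q t = (\<Sum>z\<in>X. (\<Prod>w\<in>Y. 1 - a z * b w) *
          (\<Prod>w\<in>X - {z}. (a v - a w) / (a z - a w)))"
        by (simp add: q_def v poly_sum poly_prod prod_dividef)
      also have "\<dots> = (\<Sum>z\<in>{v}. (\<Prod>w\<in>Y. 1 - a z * b w) *
          (\<Prod>w\<in>X - {z}. (a v - a w) / (a z - a w)))"
      proof (intro sum.mono_neutral_right X(1) ballI)
        fix z assume "z \<in> X - {v}"
        then have "(\<Prod>w\<in>X - {z}. (a v - a w) / (a z - a w)) = 0"
          using v X by (intro prod_zero) auto
        then show "(\<Prod>w\<in>Y. 1 - a z * b w) * (\<Prod>w\<in>X - {z}. (a v - a w) / (a z - a w)) = 0"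
          by simp
      qed (use v in auto)
      also have "(\<Prod>w\<in>X - {v}. (a v - a w) / (a v - a w)) = 1"
        using X v by (intro prod.neutral) (auto dest: inj_onD)
      then have "(\<Sum>z\<in>{v}. (\<Prod>w\<in>Y. 1 - a z * b w) *
          (\<Prod>w\<in>X - {z}. (a v - a w) / (a z - a w))) = poly p t"
        by (simp add: p_def v poly_prod)
      finally show "poly p t = poly q t" by simp
    qed
    have "?f u = u ^ card Y * poly p (1 / u)"
      using u by (simp add: p_def poly_prod right_diff_distrib flip: prod_constant prod.distrib)
    also have "\<dots> = u ^ card Y * poly q (1 / u)" by (simp add: \<open>p = q\<close>)
    also have "\<dots> = (\<Sum>z\<in>X. (\<Prod>w\<in>Y. 1 - a z * b w) / (\<Prod>w\<in>X - {z}. a z - a w) *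
                        (u ^ card (X - {z}) * (\<Prod>w\<in>X - {z}. 1 / u - a w)))"
      unfolding q_def poly_sum sum_distrib_left
    proof (intro sum.cong refl)
      fix z assume "z \<in> X"
      then have "card (X - {z}) = card Y" using X Y by simp
      then show "u ^ card Y * poly (smult ((\<Prod>w\<in>Y. 1 - a z * b w) / (\<Prod>w\<in>X - {z}. a z - a w))
            (\<Prod>w\<in>X - {z}. [:- a w, 1:])) (1 / u) =
          (\<Prod>w\<in>Y. 1 - a z * b w) / (\<Prod>w\<in>X - {z}. a z - a w) *
            (u ^ card (X - {z}) * (\<Prod>w\<in>X - {z}. 1 / u - a w))"
        by (simp add: poly_prod mult_ac)
    qed
    also have "\<dots> = ?g u"
    proof (intro sum.cong refl)
      fix z
      have "u ^ card (X - {z}) * (\<Prod>w\<in>X - {z}. 1 / u - a w) = (\<Prod>w\<in>X - {z}. 1 - u * a w)"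
        using u by (simp add: right_diff_distrib flip: prod_constant prod.distrib)
      then show "(\<Prod>w\<in>Y. 1 - a z * b w) / (\<Prod>w\<in>X - {z}. a z - a w) *
             (u ^ card (X - {z}) * (\<Prod>w\<in>X - {z}. 1 / u - a w)) =
           (\<Prod>w\<in>Y. 1 - a z * b w) * (\<Prod>w\<in>X - {z}. (1 - u * a w) / (a z - a w))"
        by (simp add: prod_dividef)
    qed
    finally show ?thesis .
  qed
  show ?thesis
  proof (cases "x = 0")
    case True
    have "isCont ?f 0" "isCont ?g 0"
      using X by (auto intro!: continuous_intros dest: inj_onD)
    then have "?f \<midarrow>0\<rightarrow> ?f 0" "?g \<midarrow>0\<rightarrow> ?g 0"
      by (simp_all only: isCont_def)
    moreover have "?f \<midarrow>0\<rightarrow> ?g 0"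
      using \<open>?g \<midarrow>0\<rightarrow> ?g 0\<close> nonzero by (subst LIM_equal[of 0 ?f ?g]) auto
    ultimately show ?thesis using True LIM_unique by blast
  qed (rule nonzero)
qed

definition pick_weight :: "complex set \<Rightarrow> complex \<Rightarrow> complex" where
  "pick_weight X z = (\<Prod>w\<in>X. 1 - cnj z * w) / (\<Prod>w\<in>X - {z}. cnj z - cnj w)"

lemma pick_weight_nonzero:
  assumes "finite X" "X \<subseteq> ball 0 1" "z \<in> X"
  shows "pick_weight X z \<noteq> 0"
proof -
  have "cnj z * w \<noteq> 1" if "w \<in> X" for w
    using cnj_mult_ne_1[of z w] that assms by blast
  then show ?thesis
    using assms by (auto simp: pick_weight_def)
qed

lemma sum_pick_weight:
  assumes X: "finite X" "X \<subseteq> ball 0 1" and xy: "x \<in> X" "y \<in> X"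
  shows "(\<Sum>z\<in>X. pick_weight X z / ((1 - cnj z * x) * (1 - cnj z * y))) =
    (if x = y then 1 / cnj (pick_weight X x) else 0)"
proof -
  have ne: "1 - cnj z * w \<noteq> 0" if "z \<in> X" "w \<in> X" for z w
    using cnj_mult_ne_1[of z w] subsetD[OF X(2)] that by simp
  define D where "D = (\<Prod>w\<in>X. 1 - x * cnj w)"
  have D: "D \<noteq> 0" using ne X xy by (auto simp: D_def mult.commute)
  have "(\<Sum>z\<in>X. pick_weight X z / ((1 - cnj z * x) * (1 - cnj z * y))) =
     (\<Sum>z\<in>X. (\<Prod>w\<in>X - {y}. 1 - cnj z * w) *
        (\<Prod>w\<in>X - {z}. (1 - x * cnj w) / (cnj z - cnj w)) / D)"
  proof (intro sum.cong refl)
    fix z assume z: "z \<in> X"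
    have "(\<Prod>w\<in>X. 1 - cnj z * w) = (1 - cnj z * y) * (\<Prod>w\<in>X - {y}. 1 - cnj z * w)"
      by (rule prod.remove[OF X(1) xy(2)])
    moreover have "D = (1 - cnj z * x) * (\<Prod>w\<in>X - {z}. 1 - x * cnj w)"
      unfolding D_def by (subst prod.remove[OF X(1) z]) (simp add: mult.commute)
    ultimately show "pick_weight X z / ((1 - cnj z * x) * (1 - cnj z * y)) =
        (\<Prod>w\<in>X - {y}. 1 - cnj z * w) *
        (\<Prod>w\<in>X - {z}. (1 - x * cnj w) / (cnj z - cnj w)) / D"
      using D ne[OF z xy(1)] ne[OF z xy(2)]
      by (auto simp: pick_weight_def prod_dividef)
  qed
  also have "\<dots> = (\<Prod>w\<in>X - {y}. x - w) / D"
    unfolding sum_divide_distrib[symmetric]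
    by (subst homogeneous_lagrange_interpolation[where X = X and a = cnj and b = "\<lambda>w. w"])
       (use X xy in \<open>auto simp: inj_on_def card_Suc_Diff1 simp del: card_Diff_insert\<close>)
  also have "\<dots> = (if x = y then 1 / cnj (pick_weight X x) else 0)"
    using X xy by (auto simp: D_def pick_weight_def)
  finally show ?thesis .
qed

lemma (in vector_space) independent_scale_family:
  assumes fin: "finite I" and inj: "inj_on f I" and ind: "independent (f ` I)"
    and c: "\<And>i. i \<in> I \<Longrightarrow> c i \<noteq> 0"
  shows "inj_on (\<lambda>i. scale (c i) (f i)) I"
    and "independent ((\<lambda>i. scale (c i) (f i)) ` I)"
proof -
  have zero: "d i = 0" if "(\<Sum>j\<in>I. scale (d j) (f j)) = 0" "i \<in> I" for d i
  proof -
    have "(\<Sum>v\<in>f ` I. scale (d (the_inv_into I f v)) v) = 0"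
      using that inj by (simp add: sum.reindex the_inv_into_f_f)
    then have "d (the_inv_into I f (f i)) = 0"
      using ind that fin by (fastforce simp: dependent_finite)
    then show ?thesis using inj that by (simp add: the_inv_into_f_f)
  qed
  show inj': "inj_on (\<lambda>i. scale (c i) (f i)) I"
  proof
    fix i j assume ij: "i \<in> I" "j \<in> I" "scale (c i) (f i) = scale (c j) (f j)"
    show "i = j"
    proof (rule ccontr)
      assume "i \<noteq> j"
      have "(\<Sum>k\<in>I. scale (if k = i then c i else if k = j then - c j else 0) (f k)) =
         (\<Sum>k\<in>{i, j}. scale (if k = i then c i else if k = j then - c j else 0) (f k))"
        using fin ij by (intro sum.mono_neutral_right) auto
      also have "\<dots> = 0" using ij \<open>i \<noteq> j\<close> by simp
      finally show False using zero[OF _ ij(1)] c[OF ij(1)] by fastforce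
    qed
  qed
  show "independent ((\<lambda>i. scale (c i) (f i)) ` I)"
  proof
    assume "dependent ((\<lambda>i. scale (c i) (f i)) ` I)"
    then obtain u i where i: "i \<in> I" "u (scale (c i) (f i)) \<noteq> 0"
      and "(\<Sum>v\<in>(\<lambda>i. scale (c i) (f i)) ` I. scale (u v) v) = 0"
      using fin by (auto simp: dependent_finite)
    then have "(\<Sum>j\<in>I. scale (u (scale (c j) (f j)) * c j) (f j)) = 0"
      by (simp add: sum.reindex[OF inj'])
    from zero[OF this i(1)] i c show False by simp
  qed
qed

lemma (in vector_space) span_scale_family:
  assumes c: "\<And>i. i \<in> I \<Longrightarrow> c i \<noteq> 0"
  shows "span ((\<lambda>i. scale (c i) (f i)) ` I) = span (f ` I)"
proof (rule span_eq[THEN iffD2], intro conjI image_subsetI)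
  fix i assume i: "i \<in> I"
  then show "scale (c i) (f i) \<in> span (f ` I)" by (intro span_scale span_base imageI)
  have "scale (1 / c i) (scale (c i) (f i)) \<in> span ((\<lambda>i. scale (c i) (f i)) ` I)"
    using i by (intro span_scale span_base imageI)
  then show "f i \<in> span ((\<lambda>i. scale (c i) (f i)) ` I)"
    using c i by simp
qed

definition rescale_kernels :: "('x \<Rightarrow> complex) \<Rightarrow> ('x, 'v) rkhs \<Rightarrow> ('x, 'v) rkhs" where
  "rescale_kernels c H = H\<lparr>kern := \<lambda>x. scal H (c x) (kern H x)\<rparr>"

lemma rescale_kernels_simps [simp]:
  "scal (rescale_kernels c H) = scal H" "vecs (rescale_kernels c H) = vecs H"
  "inn (rescale_kernels c H) = inn H" "pts (rescale_kernels c H) = pts H"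
  "kern (rescale_kernels c H) = (\<lambda>x. scal H (c x) (kern H x))"
  by (simp_all add: rescale_kernels_def)

context fd_rkhs
begin

lemma kernel_in_vecs: "x \<in> pts H \<Longrightarrow> kern H x \<in> vecs H"
  using span_kernels span_base by blast

lemma gram_rescale_kernels:
  assumes "x \<in> pts H" "y \<in> pts H"
  shows "gram (rescale_kernels c H) x y = c x * cnj (c y) * gram H x y"
proof -
  note k = assms[THEN kernel_in_vecs]
  have sy: "scal H (c y) (kern H y) \<in> vecs H"
    using subspace_scale[OF subspace_carrier k(2)] .
  have "inn H (kern H x) (scal H (c y) (kern H y)) = cnj (c y) * inn H (kern H x) (kern H y)"
    by (simp add: ip_cnj[OF k(1) sy] ip_scale_left[OF k(2,1)] ip_cnj[OF k(2,1)])
  then show ?thesis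
    by (simp add: gram_def ip_scale_left[OF k(1) sy])
qed

lemma fd_rkhs_rescale_kernels:
  assumes c: "\<And>x. x \<in> pts H \<Longrightarrow> c x \<noteq> 0"
  shows "fd_rkhs (rescale_kernels c H)"
proof -
  have "inn H (scal H (c x) (kern H x)) (scal H (c y) (kern H y)) \<noteq> 0"
    if "x \<in> pts H" "y \<in> pts H" for x y
    using gram_rescale_kernels[OF that, of c] inn_kernel_nonzero[OF that] c that
    by (simp add: gram_def)
  then show ?thesis
    using complex_inner_space_axioms finite_pts span_kernels
      independent_scale_family[OF finite_pts inj_kernel independent_kernels c]
      span_scale_family[of "pts H" c "kern H", OF c]
    by (simp add: fd_rkhs_def fd_rkhs_axioms_def)
qed

lemma rescaling_rescale_kernels:
  assumes c: "\<And>x. x \<in> pts H \<Longrightarrow> c x \<noteq> 0"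
  shows "rescaling (rescale_kernels c H) H"
  unfolding rescaling_def
  by (rule exI[of _ id], rule exI[of _ "\<lambda>x. 1 / c x"])
     (use c in \<open>auto simp: gram_rescale_kernels\<close>)

end

theorem theorem11:
  fixes H :: "('x, 'v::ab_group_add) rkhs"
  assumes "r_pick H"
  shows "r_orthogonal H"
proof -
  from assms obtain X \<Xi> \<gamma> where H: "fd_rkhs H" and X: "finite X" "X \<subseteq> ball 0 1"
    and bij: "bij_betw \<Xi> X (pts H)" and \<gamma>: "\<And>x. x \<in> X \<Longrightarrow> \<gamma> x \<noteq> 0"
    and gram: "\<And>x y. x \<in> X \<Longrightarrow> y \<in> X \<Longrightarrow>
      gram H (\<Xi> x) (\<Xi> y) = \<gamma> x * cnj (\<gamma> y) * gram (pick_space X) x y"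
    unfolding r_pick_def rescaling_def pick_space_simps by blast
  interpret fd_rkhs H by (rule H)
  define \<sigma> where "\<sigma> x = csqrt (pick_weight X x)" for x
  have \<sigma>: "\<sigma> x \<noteq> 0" if "x \<in> X" for x
    using pick_weight_nonzero[OF X that] by (simp add: \<sigma>_def)
  have \<sigma>2: "\<sigma> x * \<sigma> x = pick_weight X x" for x
    by (simp add: \<sigma>_def flip: power2_eq_square)
  define c where "c u = (let x = the_inv_into X \<Xi> u in \<sigma> x / \<gamma> x)" for u
  have c_\<Xi>: "c (\<Xi> x) = \<sigma> x / \<gamma> x" if "x \<in> X" for x
    using that bij by (simp add: c_def bij_betw_def the_inv_into_f_f)
  have pts: "pts H = \<Xi> ` X" using bij by (simp add: bij_betw_def)
  have c: "c u \<noteq> 0" if "u \<in> pts H" for u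
    using that c_\<Xi> \<sigma> \<gamma> by (auto simp: pts)
  have gram': "gram (rescale_kernels c H) (\<Xi> z) (\<Xi> x) = \<sigma> z * cnj (\<sigma> x) / (1 - cnj z * x)"
    if "z \<in> X" "x \<in> X" for z x
    using that \<gamma> hardy_inner_szego_kernel[OF subsetD[OF X(2)] subsetD[OF X(2)], of z x]
    by (auto simp: gram_rescale_kernels pts c_\<Xi> gram gram_def[of "pick_space X"] pick_space_simps)
  have "orthogonal_rkhs (rescale_kernels c H)"
    unfolding orthogonal_rkhs_def
  proof (intro ballI)
    fix u v assume "u \<in> pts (rescale_kernels c H)" "v \<in> pts (rescale_kernels c H)"
    then obtain x y where xy: "x \<in> X" "y \<in> X" "u = \<Xi> x" "v = \<Xi> y" by (auto simp: pts)
    have "(\<Sum>w\<in>pts (rescale_kernels c H).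
            gram (rescale_kernels c H) w u * gram (rescale_kernels c H) w v) =
        (\<Sum>z\<in>X. gram (rescale_kernels c H) (\<Xi> z) u * gram (rescale_kernels c H) (\<Xi> z) v)"
      by (simp add: sum.reindex_bij_betw[OF bij, symmetric])
    also have "\<dots> = cnj (\<sigma> x) * cnj (\<sigma> y) *
        (\<Sum>z\<in>X. pick_weight X z / ((1 - cnj z * x) * (1 - cnj z * y)))"
      unfolding sum_distrib_left
      by (intro sum.cong refl) (use xy in \<open>simp add: gram' mult_ac flip: \<sigma>2\<close>)
    also have "\<dots> = (if x = y then 1 else 0)"
      using \<sigma>[OF xy(1)] unfolding sum_pick_weight[OF X xy(1,2)] by (auto simp flip: \<sigma>2)
    also have "\<dots> = (if u = v then 1 else 0)"
      using bij xy by (auto simp: bij_betw_def inj_on_def)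
    finally show "(\<Sum>w\<in>pts (rescale_kernels c H).
        gram (rescale_kernels c H) w u * gram (rescale_kernels c H) w v) = (if u = v then 1 else 0)" .
  qed
  moreover have "fd_rkhs (rescale_kernels c H)" "rescaling (rescale_kernels c H) H"
    using c by (auto intro: fd_rkhs_rescale_kernels rescaling_rescale_kernels)
  ultimately show ?thesis
    unfolding r_orthogonal_def using H by blast
qed

end
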